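(* Let $G$ be a finite abelian group containing a reversible difference set $D$, and let $X$ be a subgroup of index $2$ in $G$. Then every abelian group containing $X$ as a subgroup of index $2$ contains a difference set with the same parameters as $D$.
   Context: A subset $D$ of a finite group $G$ is a $(v,k,\lambda)$-difference set if $|G|=v$, $|D|=k$, and every $g\in G\setminus\{1\}$ can be expressed in exactly $\lambda$ ways as $d_1d_2^{-1}$ with $d_1,d_2\in D$. The difference set $D$ is reversible if $D=\{d^{-1}:d\in D\}$. *)

theory Defs
  imports "HOL-Algebra.Coset"
begin

definition difference_set ::
  "('a, 'm) monoid_scheme \<Rightarrow> nat \<Rightarrow> nat \<Rightarrow> nat \<Rightarrow> 'a set \<Rightarrow> bool" where
  "difference_set G v k l D \<longleftrightarrow>
     group G \<and> finite (carrier G) \<and> D \<subseteq> carrier G \<and> order G = v \<and> card D = k \<and>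
     (\<forall>g \<in> carrier G - {\<one>\<^bsub>G\<^esub>}.
        card {(d1, d2). d1 \<in> D \<and> d2 \<in> D \<and> d1 \<otimes>\<^bsub>G\<^esub> inv\<^bsub>G\<^esub> d2 = g} = l)"

definition reversible :: "('a, 'm) monoid_scheme \<Rightarrow> 'a set \<Rightarrow> bool" where
  "reversible G D \<longleftrightarrow> D = {inv\<^bsub>G\<^esub> d | d. d \<in> D}"

text \<open>Containment is up to isomorphism, since \<open>H\<close> and \<open>K\<close> may live on different types.
  It is only meaningful for \<open>n > 0\<close>, as \<open>card\<close> is \<open>0\<close> on infinite sets.\<close>

definition contains_with_index ::
  "('b, 'n) monoid_scheme \<Rightarrow> ('a, 'm) monoid_scheme \<Rightarrow> nat \<Rightarrow> bool" where
  "contains_with_index H K n \<longleftrightarrow>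
     (\<exists>Y. subgroup Y H \<and> H\<lparr>carrier := Y\<rparr> \<cong> K \<and> card (rcosets\<^bsub>H\<^esub> Y) = n)"

end

theory Submission
  imports Defs
begin

text \<open>
  Let \<open>Y\<close> be the copy of \<open>X\<close> in \<open>H\<close>. Extend the isomorphism \<open>Y \<cong> X\<close> to a bijection
  \<open>\<psi>\<close> from \<open>H\<close> to \<open>G\<close> by matching the nontrivial coset of \<open>Y\<close> with that of \<open>X\<close>; the required
  difference set is \<open>E = {x. \<psi> x \<in> D}\<close>. The map \<open>\<psi>\<close> need not be a homomorphism, but it respects
  every product with a factor in \<open>Y\<close> (lemma \<open>index_two_extension\<close>). Hence a quotient
  \<open>x y\<^sup>-\<^sup>1\<close> is respected as soon as it lies in \<open>Y\<close> or \<open>y\<close> does, so \<open>\<psi>\<close> carries the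
  representations in \<open>E\<close> of any nontrivial \<open>z \<in> Y\<close> to the representations in \<open>D\<close> of \<open>\<psi> z\<close>, and
  there are \<open>l\<close> of these.

  For \<open>z \<notin> Y\<close> exactly one of \<open>x\<close>, \<open>y\<close> in \<open>z = x y\<^sup>-\<^sup>1\<close> lies in \<open>Y\<close>. If it is \<open>y\<close>, then
  \<open>\<psi>\<close> again respects the quotient. If it is \<open>x\<close>, then the swapped pair is a representation
  of \<open>z\<^sup>-\<^sup>1\<close> of the first kind. Now reversibility enters: in \<open>G\<close> the map
  \<open>(a, b) \<mapsto> (b\<^sup>-\<^sup>1, a\<^sup>-\<^sup>1)\<close> preserves \<open>D \<times> D\<close> and the quotient, and exchanges the two kinds, so
  every \<open>w \<notin> X\<close> has exactly \<open>l / 2\<close> representations of each kind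
  (lemma \<open>twice_card_mixed_representations\<close>). It therefore does not matter that
  \<open>\<psi> z\<close> and \<open>\<psi> (z\<^sup>-\<^sup>1)\<close> need not be inverse to each other, and \<open>z\<close> has \<open>l / 2 + l / 2 = l\<close>
  representations.
\<close>

section \<open>Subgroups of index two\<close>

text \<open>There is room for only one coset besides \<open>X\<close>, so two elements outside \<open>X\<close> lie in the
  same coset and their quotient falls into \<open>X\<close>.\<close>

lemma (in group) index_two_mult_inv_mem_iff:
  assumes "subgroup X G" and "card (rcosets X) = 2"
    and a: "a \<in> carrier G" and b: "b \<in> carrier G"
  shows "a \<otimes> inv b \<in> X \<longleftrightarrow> (a \<in> X \<longleftrightarrow> b \<in> X)"
proof -
  interpret X: subgroup X G by fact
  have mem: "c \<in> X #> c" if "c \<in> carrier G" for c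
    using that rcos_self[OF _ assms(1)] by blast
  have same: "a \<otimes> inv b \<in> X" if "a \<notin> X" "b \<notin> X"
  proof -
    have "X \<in> rcosets X" using X.subgroup_in_rcosets is_group by blast
    moreover have "X #> a \<in> rcosets X" "X #> b \<in> rcosets X"
      using a b X.subset by (auto intro: rcosetsI)
    ultimately have "X #> a = X #> b"
      using assms(2) mem[OF a] mem[OF b] that by (auto simp: card_2_iff)
    then have "a \<in> X #> b" using mem[OF a] by simp
    then show ?thesis
      using X.rcos_module_imp[OF is_group b] by blast
  qed
  have "a \<in> X" if "a \<otimes> inv b \<in> X" "b \<in> X"
  proof -
    have "(a \<otimes> inv b) \<otimes> b \<in> X" using that by blast
    then show ?thesis using a b by (simp add: m_assoc)
  qed
  moreover have "b \<in> X" if "a \<otimes> inv b \<in> X" "a \<in> X"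
  proof -
    have "inv (a \<otimes> inv b) \<otimes> a \<in> X" using that by blast
    then show ?thesis using a b by (simp add: inv_mult_group m_assoc)
  qed
  ultimately show ?thesis using same by blast
qed

lemma (in group) index_two_obtains_outside:
  assumes "subgroup X G" and "card (rcosets X) = 2"
  obtains g where "g \<in> carrier G" "g \<notin> X"
proof -
  interpret X: subgroup X G by fact
  have "rcosets X \<subseteq> {X}" if "carrier G \<subseteq> X"
    using that assms(1) by (auto simp: RCOSETS_def X.rcos_const)
  then have "\<not> carrier G \<subseteq> X"
    using assms(2) card_mono[of "{X}" "rcosets X"] by fastforce
  then show ?thesis using that by blast
qed

text \<open>The extension maps \<open>Yh\<close> to \<open>Xg\<close> by \<open>yh \<mapsto> \<phi>(y)g\<close> for arbitrary \<open>h\<close>, \<open>g\<close>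
  outside the subgroups. No relation between \<open>h\<^sup>2\<close> and \<open>g\<^sup>2\<close> is available, so only factors from
  \<open>Y\<close> can be pulled out.\<close>

lemma index_two_extension:
  assumes "group H" and "group G"
    and Y: "subgroup Y H" "card (rcosets\<^bsub>H\<^esub> Y) = 2"
    and X: "subgroup X G" "card (rcosets\<^bsub>G\<^esub> X) = 2"
    and iso: "H\<lparr>carrier := Y\<rparr> \<cong> G\<lparr>carrier := X\<rparr>"
  obtains \<psi> where "bij_betw \<psi> (carrier H) (carrier G)"
    and "\<And>x. x \<in> carrier H \<Longrightarrow> \<psi> x \<in> X \<longleftrightarrow> x \<in> Y"
    and "\<And>w x. w \<in> Y \<Longrightarrow> x \<in> carrier H \<Longrightarrow> \<psi> (w \<otimes>\<^bsub>H\<^esub> x) = \<psi> w \<otimes>\<^bsub>G\<^esub> \<psi> x"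
proof -
  interpret H: group H by fact
  interpret G: group G by fact
  interpret Y: subgroup Y H by fact
  interpret X: subgroup X G by fact
  obtain \<phi> where "\<phi> \<in> iso (H\<lparr>carrier := Y\<rparr>) (G\<lparr>carrier := X\<rparr>)"
    using iso by (auto simp: is_iso_def)
  then have bij: "bij_betw \<phi> Y X"
    and mult: "\<And>x y. x \<in> Y \<Longrightarrow> y \<in> Y \<Longrightarrow> \<phi> (x \<otimes>\<^bsub>H\<^esub> y) = \<phi> x \<otimes>\<^bsub>G\<^esub> \<phi> y"
    by (auto simp: iso_def hom_def)
  have into: "\<phi> y \<in> X" if "y \<in> Y" for y
    using bij that by (auto simp: bij_betw_def)
  obtain h where h: "h \<in> carrier H" "h \<notin> Y"
    using H.index_two_obtains_outside Y by blast
  obtain g where g: "g \<in> carrier G" "g \<notin> X"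
    using G.index_two_obtains_outside X by blast
  have Yh: "x \<otimes>\<^bsub>H\<^esub> inv\<^bsub>H\<^esub> h \<in> Y" if "x \<in> carrier H" "x \<notin> Y" for x
    using H.index_two_mult_inv_mem_iff[OF Y that(1) h(1)] that h by blast
  have Yout: "w \<otimes>\<^bsub>H\<^esub> x \<notin> Y" if "w \<in> Y" "x \<in> carrier H" "x \<notin> Y" for w x
  proof
    assume "w \<otimes>\<^bsub>H\<^esub> x \<in> Y"
    then have "inv\<^bsub>H\<^esub> w \<otimes>\<^bsub>H\<^esub> (w \<otimes>\<^bsub>H\<^esub> x) \<in> Y" using that by blast
    then show False using that by (simp add: H.m_assoc[symmetric])
  qed
  have Xout: "w \<otimes>\<^bsub>G\<^esub> g \<notin> X" if "w \<in> X" for w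
  proof
    assume "w \<otimes>\<^bsub>G\<^esub> g \<in> X"
    then have "inv\<^bsub>G\<^esub> w \<otimes>\<^bsub>G\<^esub> (w \<otimes>\<^bsub>G\<^esub> g) \<in> X" using that by blast
    then show False using that g by (simp add: G.m_assoc[symmetric])
  qed
  define \<psi> where "\<psi> x = (if x \<in> Y then \<phi> x else \<phi> (x \<otimes>\<^bsub>H\<^esub> inv\<^bsub>H\<^esub> h) \<otimes>\<^bsub>G\<^esub> g)" for x
  have closed: "\<psi> x \<in> carrier G" if "x \<in> carrier H" for x
    using that into Yh g by (auto simp: \<psi>_def)
  have coset: "\<psi> x \<in> X \<longleftrightarrow> x \<in> Y" if "x \<in> carrier H" for x
    using that into Yh Xout by (auto simp: \<psi>_def)
  have hom: "\<psi> (w \<otimes>\<^bsub>H\<^esub> x) = \<psi> w \<otimes>\<^bsub>G\<^esub> \<psi> x" if "w \<in> Y" "x \<in> carrier H" for w x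
  proof (cases "x \<in> Y")
    case True
    then show ?thesis using that mult by (simp add: \<psi>_def)
  next
    case False
    then show ?thesis
      using that h g Yh[OF that(2) False] Yout[OF that False] into
      by (simp add: \<psi>_def H.m_assoc G.m_assoc mult)
  qed
  have "inj_on \<psi> (carrier H)"
  proof (rule inj_onI)
    fix x y
    assume x: "x \<in> carrier H" and y: "y \<in> carrier H" and eq: "\<psi> x = \<psi> y"
    define w where "w = x \<otimes>\<^bsub>H\<^esub> inv\<^bsub>H\<^esub> y"
    have w: "w \<in> Y"
      using H.index_two_mult_inv_mem_iff[OF Y x y] coset[OF x] coset[OF y] eq
      by (simp add: w_def)
    have xw: "x = w \<otimes>\<^bsub>H\<^esub> y" using x y by (simp add: w_def H.m_assoc)
    then have "\<psi> w \<otimes>\<^bsub>G\<^esub> \<psi> y = \<psi> y" using hom[OF w y] eq by simp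
    then have "\<psi> w = \<one>\<^bsub>G\<^esub>" using closed w y by (metis G.r_cancel_one Y.mem_carrier)
    moreover have "\<psi> \<one>\<^bsub>H\<^esub> \<otimes>\<^bsub>G\<^esub> \<psi> y = \<psi> y"
      using hom[OF Y.one_closed y] y by simp
    then have "\<psi> \<one>\<^bsub>H\<^esub> = \<one>\<^bsub>G\<^esub>" using closed y by (metis G.r_cancel_one H.one_closed)
    ultimately have "w = \<one>\<^bsub>H\<^esub>"
      using bij w inj_onD[of \<phi> Y w "\<one>\<^bsub>H\<^esub>"] by (auto simp: \<psi>_def bij_betw_def)
    then show "x = y" using xw y by simp
  qed
  moreover have "c \<in> \<psi> ` carrier H" if c: "c \<in> carrier G" for c
  proof (cases "c \<in> X")
    case True
    then obtain y where "y \<in> Y" "\<phi> y = c" using bij by (auto simp: bij_betw_def)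
    then show ?thesis by (intro image_eqI[of _ _ y]) (auto simp: \<psi>_def)
  next
    case False
    then have "c \<otimes>\<^bsub>G\<^esub> inv\<^bsub>G\<^esub> g \<in> X"
      using G.index_two_mult_inv_mem_iff[OF X c g(1)] g by blast
    then obtain y where y: "y \<in> Y" "\<phi> y = c \<otimes>\<^bsub>G\<^esub> inv\<^bsub>G\<^esub> g"
      using bij by (auto simp: bij_betw_def)
    have "\<psi> (y \<otimes>\<^bsub>H\<^esub> h) = c"
      using y h g c Yout[OF y(1) h] by (simp add: \<psi>_def H.m_assoc G.m_assoc)
    then show ?thesis using y h by (metis H.m_closed Y.mem_carrier image_eqI)
  qed
  ultimately have "bij_betw \<psi> (carrier H) (carrier G)"
    using closed by (auto simp: bij_betw_def)
  then show ?thesis using coset hom that by blast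
qed

section \<open>Representations in a reversible difference set\<close>

text \<open>Exactly one of \<open>a\<close>, \<open>b\<close> lies in \<open>X\<close> when \<open>a b\<^sup>-\<^sup>1 = z\<close>. Passing from \<open>(a, b)\<close> to
  \<open>(b\<^sup>-\<^sup>1, a\<^sup>-\<^sup>1)\<close> stays within the \<open>l\<close> representations of \<open>z\<close>, by reversibility and commutativity,
  and switches which entry lies in \<open>X\<close>; so both kinds are equally frequent.\<close>

lemma (in comm_group) twice_card_mixed_representations:
  assumes D: "difference_set G v k l D" and rev: "reversible G D"
    and X: "subgroup X G" "card (rcosets X) = 2"
    and z: "z \<in> carrier G" "z \<notin> X"
  shows "2 * card {(a, b). a \<in> D \<and> b \<in> D \<and> b \<in> X \<and> a \<otimes> inv b = z} = l"
proof -
  interpret X: subgroup X G by fact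
  have DG: "D \<subseteq> carrier G" and fin: "finite D"
    using D finite_subset by (auto simp: difference_set_def)
  have invD: "inv d \<in> D" if "d \<in> D" for d
    using rev that unfolding reversible_def by blast
  define R where "R = {(a, b). a \<in> D \<and> b \<in> D \<and> a \<otimes> inv b = z}"
  define S where "S = {(a, b). a \<in> D \<and> b \<in> D \<and> b \<in> X \<and> a \<otimes> inv b = z}"
  define T where "T = {(a, b). a \<in> D \<and> b \<in> D \<and> a \<in> X \<and> a \<otimes> inv b = z}"
  have opp: "a \<in> X \<longleftrightarrow> b \<notin> X" if "a \<in> D" "b \<in> D" "a \<otimes> inv b = z" for a b
    using index_two_mult_inv_mem_iff[OF X, of a b] that DG z by blast
  have "R = S \<union> T" "S \<inter> T = {}"
    using opp by (auto simp: R_def S_def T_def)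
  moreover have "finite R"
    by (rule finite_subset[of _ "D \<times> D"]) (auto simp: R_def fin)
  ultimately have "card R = card S + card T"
    by (metis card_Un_disjoint finite_Un)
  moreover have "card R = l"
    using D z by (auto simp: difference_set_def R_def)
  moreover
  have swap: "inv b \<otimes> a = a \<otimes> inv b" if "a \<in> D" "b \<in> D" for a b
    using that DG by (metis subsetD inv_closed m_comm)
  have inv_X: "inv d \<in> X \<longleftrightarrow> d \<in> X" if "d \<in> D" for d
    using that DG X.m_inv_closed inv_inv by (metis subsetD)
  have "bij_betw (\<lambda>(a, b). (inv b, inv a)) S T"
    by (rule bij_betw_byWitness[where f' = "\<lambda>(a, b). (inv b, inv a)"])
      (use DG in \<open>auto simp: S_def T_def swap inv_X invD subset_iff\<close>)
  then have "card S = card T" by (rule bij_betw_same_card)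
  ultimately show ?thesis by (simp add: S_def)
qed

section \<open>Transfer of the difference set\<close>

lemma card_pairs_bij_betw:
  assumes bij: "bij_betw f A B"
    and PQ: "\<And>x y. x \<in> A \<Longrightarrow> y \<in> A \<Longrightarrow> P x y \<longleftrightarrow> Q (f x) (f y)"
  shows "card {(x, y). x \<in> A \<and> y \<in> A \<and> P x y} = card {(a, b). a \<in> B \<and> b \<in> B \<and> Q a b}"
    (is "card ?S = card ?T")
proof -
  have "B = f ` A" using bij by (simp add: bij_betw_def)
  then have "map_prod f f ` ?S = ?T"
    using PQ by (auto simp: image_iff Bex_def)
  moreover have "inj_on (map_prod f f) ?S"
    using bij by (auto simp: bij_betw_def inj_on_def)
  ultimately have "bij_betw (map_prod f f) ?S ?T" by (simp add: bij_betw_def)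
  then show ?thesis by (rule bij_betw_same_card)
qed

theorem corollary3p3:
  fixes G :: "('a, 'm) monoid_scheme" and H :: "('b, 'n) monoid_scheme"
    and D X :: "'a set" and v k l :: nat
  assumes "comm_group G" and "finite (carrier G)"
    and "difference_set G v k l D" and "reversible G D"
    and "subgroup X G" and "card (rcosets\<^bsub>G\<^esub> X) = 2"
    and "comm_group H" and "contains_with_index H (G\<lparr>carrier := X\<rparr>) 2"
  shows "\<exists>E. difference_set H v k l E"
proof -
  interpret G: comm_group G by fact
  interpret H: comm_group H by fact
  interpret X: subgroup X G by fact
  obtain Y where Y: "subgroup Y H" "card (rcosets\<^bsub>H\<^esub> Y) = 2"
    and iso: "H\<lparr>carrier := Y\<rparr> \<cong> G\<lparr>carrier := X\<rparr>"
    using assms(8) by (auto simp: contains_with_index_def)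
  interpret Y: subgroup Y H by fact
  note X = assms(5,6)
  obtain \<psi> where bij: "bij_betw \<psi> (carrier H) (carrier G)"
    and coset: "\<And>x. x \<in> carrier H \<Longrightarrow> \<psi> x \<in> X \<longleftrightarrow> x \<in> Y"
    and hom: "\<And>w x. w \<in> Y \<Longrightarrow> x \<in> carrier H \<Longrightarrow> \<psi> (w \<otimes>\<^bsub>H\<^esub> x) = \<psi> w \<otimes>\<^bsub>G\<^esub> \<psi> x"
    using index_two_extension[OF H.is_group G.is_group Y X iso] by blast
  have \<psi>G: "\<psi> x \<in> carrier G" if "x \<in> carrier H" for x
    using bij that by (auto simp: bij_betw_def)
  have \<psi>_eq: "\<psi> x = \<psi> y \<longleftrightarrow> x = y" if "x \<in> carrier H" "y \<in> carrier H" for x y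
    using bij that by (auto simp: bij_betw_def dest: inj_onD)
  have DG: "D \<subseteq> carrier G"
    using assms(3) by (simp add: difference_set_def)
  define E where "E = {x \<in> carrier H. \<psi> x \<in> D}"
  have bijE: "bij_betw \<psi> E D"
    using bij DG by (auto simp: E_def bij_betw_def inj_on_def)
  have finH: "finite (carrier H)"
    using bij assms(2) bij_betw_finite by blast
  have EH: "E \<subseteq> carrier H" by (auto simp: E_def)
  have finE: "finite E" using EH finH finite_subset by blast

  have quot: "\<psi> (x \<otimes>\<^bsub>H\<^esub> inv\<^bsub>H\<^esub> y) = \<psi> x \<otimes>\<^bsub>G\<^esub> inv\<^bsub>G\<^esub> \<psi> y"
    if x: "x \<in> carrier H" and y: "y \<in> carrier H"
      and or: "x \<otimes>\<^bsub>H\<^esub> inv\<^bsub>H\<^esub> y \<in> Y \<or> y \<in> Y" for x y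
  proof -
    let ?w = "x \<otimes>\<^bsub>H\<^esub> inv\<^bsub>H\<^esub> y"
    have w: "?w \<in> carrier H" using x y by simp
    have xw: "?w \<otimes>\<^bsub>H\<^esub> y = x" using x y by (simp add: H.m_assoc)
    have "\<psi> ?w \<otimes>\<^bsub>G\<^esub> \<psi> y = \<psi> x"
      using or
    proof
      assume "?w \<in> Y"
      then show ?thesis using hom[of ?w y] xw y by simp
    next
      assume "y \<in> Y"
      then have "\<psi> (y \<otimes>\<^bsub>H\<^esub> ?w) = \<psi> y \<otimes>\<^bsub>G\<^esub> \<psi> ?w" using hom w by blast
      then show ?thesis
        using xw H.m_comm[OF w y] G.m_comm[OF \<psi>G[OF w] \<psi>G[OF y]] by simp
    qed
    then show ?thesis
      using \<psi>G[OF w] \<psi>G[OF x] \<psi>G[OF y] by (metis G.inv_solve_right)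
  qed
  have \<psi>_one: "\<psi> \<one>\<^bsub>H\<^esub> = \<one>\<^bsub>G\<^esub>"
    using quot[of "\<one>\<^bsub>H\<^esub>" "\<one>\<^bsub>H\<^esub>"] \<psi>G[of "\<one>\<^bsub>H\<^esub>"] by simp

  have mixed: "2 * card {(x, y). x \<in> E \<and> y \<in> E \<and> y \<in> Y \<and> x \<otimes>\<^bsub>H\<^esub> inv\<^bsub>H\<^esub> y = z} = l"
    (is "2 * card ?M = l") if z: "z \<in> carrier H" "z \<notin> Y" for z
  proof -
    have "y \<in> Y \<and> x \<otimes>\<^bsub>H\<^esub> inv\<^bsub>H\<^esub> y = z \<longleftrightarrow> \<psi> y \<in> X \<and> \<psi> x \<otimes>\<^bsub>G\<^esub> inv\<^bsub>G\<^esub> \<psi> y = \<psi> z"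
      if "x \<in> E" "y \<in> E" for x y
    proof -
      have xy: "x \<in> carrier H" "y \<in> carrier H" using that EH by auto
      show ?thesis
        using quot[OF xy] coset[OF xy(2)] \<psi>_eq[of "x \<otimes>\<^bsub>H\<^esub> inv\<^bsub>H\<^esub> y" z] xy z by auto
    qed
    then have "card ?M
        = card {(a, b). a \<in> D \<and> b \<in> D \<and> b \<in> X \<and> a \<otimes>\<^bsub>G\<^esub> inv\<^bsub>G\<^esub> b = \<psi> z}"
      by (rule card_pairs_bij_betw[OF bijE])
    then show ?thesis
      using G.twice_card_mixed_representations[OF assms(3,4) X, of "\<psi> z"] z \<psi>G coset by simp
  qed

  have "card {(x, y). x \<in> E \<and> y \<in> E \<and> x \<otimes>\<^bsub>H\<^esub> inv\<^bsub>H\<^esub> y = z} = l" (is "card ?R = l")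
    if z: "z \<in> carrier H" "z \<noteq> \<one>\<^bsub>H\<^esub>" for z
  proof (cases "z \<in> Y")
    case True
    have "x \<otimes>\<^bsub>H\<^esub> inv\<^bsub>H\<^esub> y = z \<longleftrightarrow> \<psi> x \<otimes>\<^bsub>G\<^esub> inv\<^bsub>G\<^esub> \<psi> y = \<psi> z"
      if "x \<in> E" "y \<in> E" for x y
    proof -
      have xy: "x \<in> carrier H" "y \<in> carrier H" using that EH by auto
      \<comment> \<open>Either equation puts a quotient into the subgroup, hence \<open>x\<close> and \<open>y\<close> into a common
        coset, and then \<open>\<psi>\<close> respects their quotient.\<close>
      have "x \<otimes>\<^bsub>H\<^esub> inv\<^bsub>H\<^esub> y \<in> Y \<longleftrightarrow> \<psi> x \<otimes>\<^bsub>G\<^esub> inv\<^bsub>G\<^esub> \<psi> y \<in> X"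
        using H.index_two_mult_inv_mem_iff[OF Y xy] coset xy
          G.index_two_mult_inv_mem_iff[OF X \<psi>G[OF xy(1)] \<psi>G[OF xy(2)]] by simp
      moreover have "\<psi> z \<in> X" using coset z True by simp
      ultimately show ?thesis
        using quot[OF xy] \<psi>_eq[of "x \<otimes>\<^bsub>H\<^esub> inv\<^bsub>H\<^esub> y" z] xy z True by auto
    qed
    then have "card ?R = card {(a, b). a \<in> D \<and> b \<in> D \<and> a \<otimes>\<^bsub>G\<^esub> inv\<^bsub>G\<^esub> b = \<psi> z}"
      (is "_ = card ?N")
      by (rule card_pairs_bij_betw[OF bijE])
    moreover have "\<psi> z \<noteq> \<one>\<^bsub>G\<^esub>"
      using \<psi>_eq[of z "\<one>\<^bsub>H\<^esub>"] \<psi>_one z by simp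
    then have "card ?N = l"
      using assms(3) \<psi>G[OF z(1)] by (simp add: difference_set_def)
    ultimately show ?thesis by simp
  next
    case False
    let ?S = "\<lambda>u. {(x, y). x \<in> E \<and> y \<in> E \<and> y \<in> Y \<and> x \<otimes>\<^bsub>H\<^esub> inv\<^bsub>H\<^esub> y = u}"
    have invz: "inv\<^bsub>H\<^esub> z \<in> carrier H" "inv\<^bsub>H\<^esub> z \<notin> Y"
      using z False Y.m_inv_closed H.inv_inv by (simp, metis)
    have opp: "x \<in> Y \<longleftrightarrow> y \<notin> Y" if "x \<in> E" "y \<in> E" "x \<otimes>\<^bsub>H\<^esub> inv\<^bsub>H\<^esub> y = z" for x y
      using H.index_two_mult_inv_mem_iff[OF Y, of x y] that EH False by blast
    have swap: "y \<otimes>\<^bsub>H\<^esub> inv\<^bsub>H\<^esub> x = inv\<^bsub>H\<^esub> z \<longleftrightarrow> x \<otimes>\<^bsub>H\<^esub> inv\<^bsub>H\<^esub> y = z"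
      if "x \<in> E" "y \<in> E" for x y
    proof -
      have xy: "x \<in> carrier H" "y \<in> carrier H" using that EH by auto
      have "y \<otimes>\<^bsub>H\<^esub> inv\<^bsub>H\<^esub> x = inv\<^bsub>H\<^esub> (x \<otimes>\<^bsub>H\<^esub> inv\<^bsub>H\<^esub> y)"
        using xy by (simp add: H.inv_mult_group)
      then show ?thesis
        using xy z H.inv_inv H.m_closed H.inv_closed by metis
    qed
    \<comment> \<open>Where \<open>x \<in> Y\<close> and \<open>y \<notin> Y\<close>, the map \<open>\<psi>\<close> need not respect \<open>x y\<^sup>-\<^sup>1\<close>; swapping the entries
      leads back to the controlled case, at the price of counting for \<open>z\<^sup>-\<^sup>1\<close>.\<close>
    let ?T = "{(x, y). x \<in> E \<and> y \<in> E \<and> x \<in> Y \<and> x \<otimes>\<^bsub>H\<^esub> inv\<^bsub>H\<^esub> y = z}"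
    have "?T = (?S (inv\<^bsub>H\<^esub> z))\<inverse>" using swap by blast
    then have cardT: "card ?T = card (?S (inv\<^bsub>H\<^esub> z))" by (simp only: card_inverse)
    have R: "?R = ?S z \<union> ?T" using opp by blast
    have disj: "?S z \<inter> ?T = {}" using opp by blast
    have "finite ?R"
      by (rule finite_subset[of _ "E \<times> E"]) (auto simp: finE)
    then have "card ?R = card (?S z) + card ?T"
      unfolding R finite_Un by (elim conjE) (rule card_Un_disjoint[OF _ _ disj])
    then show ?thesis
      using cardT mixed[OF z(1) False] mixed[OF invz] by linarith
  qed
  then have "difference_set H v k l E"
    using assms(3) bij_betw_same_card[OF bij] bij_betw_same_card[OF bijE] finH EH H.is_group
    by (simp add: difference_set_def order_def)
  then show ?thesis by blast
qed

end
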